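(* Consider the infinite-horizon BCR-SOC/MDP problem and the Bellman operators $\mathcal T$, $\mathcal T^\pi$ on $\mathfrak B(\mathcal S,\mathcal D_1^0)$ described in the context. Assume the transition map $g$ and cost $\mathcal C$ are time-invariant, $|\mathcal C(s,a,\xi)|\le\bar{\mathcal C}$ for all $(s,a,\xi)\in\mathcal S\times\mathcal A\times\Xi$, and $\gamma\in(0,1)$. Then: (i) The equations $\mathcal T V=V$ and $\mathcal T^\pi V=V$ have unique solutions $V^*$ and $V^\pi$ in $\mathfrak B(\mathcal S,\mathcal D_1^0)$, respectively. Moreover, for any $V\in\mathfrak B(\mathcal S,\mathcal D_1^0)$, if $V\ge\mathcal T V$ then $V\ge V^*$, and if $V\le\mathcal T V$ then $V\le V^*$. (ii) The optimal value $\mathcal J_\infty^{\gamma,*}$ of the infinite-horizon BCR-SOC/MDP problem is the unique solution of the Bellman equation $\mathcal T V=V$, i.e. $$\mathcal J_\infty^{\gamma,*}(s,\mu)= V^*(s,\mu),\qquad\forall (s,\mu)\in\mathcal S\times\mathcal D_1^0.$$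
   Context: Risk measures: a map $\rho:L^p\to\mathbb R$ is a monetary risk measure if $X\ge Y$ pointwise implies $\rho(X)\ge\rho(Y)$ and $\rho(X+c)=\rho(X)+c$ for $c\in\mathbb R$; it is law invariant if $\rho(X)$ depends only on the distribution of $X$. The inner and outer risk measures are law invariant monetary risk measures. $\rho_{P_\theta}(Z(\xi))$ is the value of the inner risk measure at the law of $Z(\xi)$ when $\xi\sim P_\theta$; for a density $\mu$ on $\Theta\subseteq\mathbb R$, $\rho_\mu(Y(\theta))$ is the value of the outer risk measure at the law of $Y(\theta)$, $\theta\sim\mu$; $\rho_\mu\circ\rho_{P_\theta}(Z):=\rho_\mu(\theta\mapsto\rho_{P_\theta}(Z(\xi)))$. $\mathcal S$ is the state space, $\mathcal A$ a compact convex action space, $\Xi$ the support of $\xi$, $g:\mathcal S\times\mathcal A\times\Xi\to\mathcal S$, $\mathcal C:\mathcal S\times\mathcal A\times\Xi\to\mathbb R$; $\mathcal D_1^0$ is the set of probability densities on $\Theta$; $p(\cdot|\theta)$ is the density of $P_\theta$. Write $s'=g(s,a,\xi)$ and $\mu'(\theta)=\frac{p(\xi|\theta)\mu(\theta)}{\int_\Theta p(\xi|\theta)\mu(\theta)d\theta}$. Infinite-horizon problem: minimize over stationary policies $\pi:\mathcal S\times\mathcal D_1^0\to\mathcal A$ the value $$\mathcal J_\infty^\gamma(\pi,s_1,\mu_1)=\rho_{\mu_1}\circ\rho_{P_{\theta_1}}\big[\mathcal C(s_1,a_1,\xi_1)+\cdots+\gamma\rho_{\mu_t}\circ\rho_{P_{\theta_t}}[\mathcal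 C(s_t,a_t,\xi_t)+\cdots]\big],$$ (the limit as $n\to\infty$ of the $n$-stage nested values) subject to $s_{t+1}=g(s_t,a_t,\xi_t)$, $a_t=\pi(s_t,\mu_t)$, $\mu_{t+1}$ the Bayes update of $\mu_t$ given $\xi_t$, with $\theta_t$ having density $\mu_t$. $\mathcal J_\infty^{\gamma,*}(s,\mu)$ is its optimal value with $s_1=s,\mu_1=\mu$. $\mathfrak B(\mathcal S,\mathcal D_1^0)$ is the space of real-valued bounded measurable functions on $\mathcal S\times\mathcal D_1^0$. The operators on it are $$(\mathcal T V)(s,\mu)=\min_{a\in\mathcal A}\rho_\mu\circ\rho_{P_\theta}\big(\mathcal C(s,a,\xi)+\gamma V(s',\mu')\big),\qquad (\mathcal T^\pi V)(s,\mu)=\rho_\mu\circ\rho_{P_\theta}\big(\mathcal C(s,\pi(s,\mu),\xi)+\gamma V(s',\mu')\big)$$ (in the second, $s'=g(s,\pi(s,\mu),\xi)$); as part of the definition the minimum is taken to be attained and the operators to map $\mathfrak B(\mathcal S,\mathcal D_1^0)$ into itself. Inequalities between functions are pointwise. *)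

theory Defs
  imports "HOL-Probability.Probability"
begin

definition Lp_space :: "'w measure \<Rightarrow> ennreal \<Rightarrow> ('w \<Rightarrow> real) set" where
  "Lp_space M p = {X \<in> borel_measurable M.
     if p = \<infinity> then (\<exists>c. AE w in M. \<bar>X w\<bar> \<le> c)
     else integrable M (\<lambda>w. \<bar>X w\<bar> powr enn2real p)}"

definition monetary_risk_measure ::
    "'w measure \<Rightarrow> ennreal \<Rightarrow> (('w \<Rightarrow> real) \<Rightarrow> real) \<Rightarrow> bool" where
  "monetary_risk_measure M p \<rho> \<longleftrightarrow>
     (\<forall>X \<in> Lp_space M p. \<forall>Y \<in> Lp_space M p. (\<forall>w \<in> space M. X w \<ge> Y w) \<longrightarrow> \<rho> X \<ge> \<rho> Y) \<and>
     (\<forall>X \<in> Lp_space M p. \<forall>c. \<rho> (\<lambda>w. X w + c) = \<rho> X + c)"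

definition law_invariant ::
    "'w measure \<Rightarrow> ennreal \<Rightarrow> (('w \<Rightarrow> real) \<Rightarrow> real) \<Rightarrow> bool" where
  "law_invariant M p \<rho> \<longleftrightarrow>
     (\<forall>X \<in> Lp_space M p. \<forall>Y \<in> Lp_space M p.
        distr M borel X = distr M borel Y \<longrightarrow> \<rho> X = \<rho> Y)"

(* For law invariant rho the choice of the representative X is immaterial. *)
definition risk_at_law ::
    "'w measure \<Rightarrow> ennreal \<Rightarrow> (('w \<Rightarrow> real) \<Rightarrow> real) \<Rightarrow> real measure \<Rightarrow> real" where
  "risk_at_law M p \<rho> Q = \<rho> (SOME X. X \<in> Lp_space M p \<and> distr M borel X = Q)"

(* Densities vanish off \<Theta>, so that each density on \<Theta> is represented by exactly one function. *)
definition prob_densities :: "real set \<Rightarrow> (real \<Rightarrow> real) set" where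
  "prob_densities \<Theta> = {\<mu> \<in> borel_measurable borel.
     (\<forall>\<theta>. 0 \<le> \<mu> \<theta>) \<and> (\<forall>\<theta>. \<theta> \<notin> \<Theta> \<longrightarrow> \<mu> \<theta> = 0) \<and> (\<integral>\<^sup>+ \<theta>. ennreal (\<mu> \<theta>) \<partial>lborel) = 1}"

(* probsp and p_exp are the probability space and the exponent of the L^p space on which both risk
   measures live. noise is the dominating measure for the densities lik \<theta> = p(.|\<theta>), with \<Xi> as
   its space. states and beliefs only serve to carry the sigma-algebras on S and on the set of
   densities; the latter sigma-algebra is arbitrary. *)
record ('w, 'x, 's, 'a) bcr_mdp =
  probsp :: "'w measure"
  p_exp :: ennreal
  inner_risk :: "('w \<Rightarrow> real) \<Rightarrow> real"
  outer_risk :: "('w \<Rightarrow> real) \<Rightarrow> real"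
  params :: "real set"
  noise :: "'x measure"
  lik :: "real \<Rightarrow> 'x \<Rightarrow> real"
  states :: "'s measure"
  beliefs :: "(real \<Rightarrow> real) measure"
  actions :: "'a set"
  trans_map :: "'s \<Rightarrow> 'a \<Rightarrow> 'x \<Rightarrow> 's"
  cost :: "'s \<Rightarrow> 'a \<Rightarrow> 'x \<Rightarrow> real"
  discount :: real

(* The uniform random variable makes the probability space rich enough for every law on the reals
   to be the law of some random variable, so that a law invariant risk measure has a value at
   every law with finite p-th moment. *)
definition is_bcr_mdp :: "('w, 'x, 's, 'a :: real_normed_vector) bcr_mdp \<Rightarrow> bool" where
  "is_bcr_mdp M \<longleftrightarrow>
     prob_space (probsp M) \<and>
     (\<exists>U :: 'w \<Rightarrow> real. U \<in> borel_measurable (probsp M) \<and>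
        distr (probsp M) borel U = uniform_measure lborel {0..1}) \<and>
     1 \<le> p_exp M \<and>
     monetary_risk_measure (probsp M) (p_exp M) (inner_risk M) \<and>
     law_invariant (probsp M) (p_exp M) (inner_risk M) \<and>
     monetary_risk_measure (probsp M) (p_exp M) (outer_risk M) \<and>
     law_invariant (probsp M) (p_exp M) (outer_risk M) \<and>
     params M \<in> sets borel \<and>
     sigma_finite_measure (noise M) \<and>
     case_prod (lik M) \<in> borel_measurable (restrict_space borel (params M) \<Otimes>\<^sub>M noise M) \<and>
     (\<forall>\<theta> \<in> params M. (\<forall>\<xi> \<in> space (noise M). 0 \<le> lik M \<theta> \<xi>) \<and>
        (\<integral>\<^sup>+ \<xi>. ennreal (lik M \<theta> \<xi>) \<partial>noise M) = 1) \<and>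
     space (beliefs M) = prob_densities (params M) \<and>
     compact (actions M) \<and> convex (actions M) \<and>
     (\<forall>s \<in> space (states M). \<forall>a \<in> actions M. \<forall>\<xi> \<in> space (noise M).
        trans_map M s a \<xi> \<in> space (states M))"

definition model_law :: "('w, 'x, 's, 'a) bcr_mdp \<Rightarrow> real \<Rightarrow> 'x measure" where
  "model_law M \<theta> = density (noise M) (\<lambda>\<xi>. ennreal (lik M \<theta> \<xi>))"

definition belief_law :: "('w, 'x, 's, 'a) bcr_mdp \<Rightarrow> (real \<Rightarrow> real) \<Rightarrow> real measure" where
  "belief_law M \<mu> = density (restrict_space lborel (params M)) (\<lambda>\<theta>. ennreal (\<mu> \<theta>))"

(* The quotient in Bayes' formula is a density exactly when its denominator is positive and finite
   (the Bochner integral is 0 if the denominator is infinite). The remaining \<xi> have probability 0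
   under P_\<theta> for almost all \<theta> ~ \<mu>, so the convention chosen for them is immaterial. *)
definition bayes_update ::
    "('w, 'x, 's, 'a) bcr_mdp \<Rightarrow> (real \<Rightarrow> real) \<Rightarrow> 'x \<Rightarrow> (real \<Rightarrow> real)" where
  "bayes_update M \<mu> \<xi> =
     (let Z = (LBINT \<theta>:params M. lik M \<theta> \<xi> * \<mu> \<theta>)
      in if Z > 0 then (\<lambda>\<theta>. lik M \<theta> \<xi> * \<mu> \<theta> / Z) else \<mu>)"

definition inner_value :: "('w, 'x, 's, 'a) bcr_mdp \<Rightarrow> ('x \<Rightarrow> real) \<Rightarrow> real \<Rightarrow> real" where
  "inner_value M Z \<theta> =
     risk_at_law (probsp M) (p_exp M) (inner_risk M) (distr (model_law M \<theta>) borel Z)"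

definition outer_value ::
    "('w, 'x, 's, 'a) bcr_mdp \<Rightarrow> (real \<Rightarrow> real) \<Rightarrow> (real \<Rightarrow> real) \<Rightarrow> real" where
  "outer_value M \<mu> Y =
     risk_at_law (probsp M) (p_exp M) (outer_risk M) (distr (belief_law M \<mu>) borel Y)"

definition composite_risk ::
    "('w, 'x, 's, 'a) bcr_mdp \<Rightarrow> (real \<Rightarrow> real) \<Rightarrow> ('x \<Rightarrow> real) \<Rightarrow> real" where
  "composite_risk M \<mu> Z = outer_value M \<mu> (inner_value M Z)"

(* The arguments of both risk measures in composite_risk M \<mu> Z lie in L^p. *)
definition composite_risk_defined ::
    "('w, 'x, 's, 'a) bcr_mdp \<Rightarrow> (real \<Rightarrow> real) \<Rightarrow> ('x \<Rightarrow> real) \<Rightarrow> bool" where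
  "composite_risk_defined M \<mu> Z \<longleftrightarrow>
     (\<forall>\<theta> \<in> params M. Z \<in> Lp_space (model_law M \<theta>) (p_exp M)) \<and>
     inner_value M Z \<in> Lp_space (belief_law M \<mu>) (p_exp M)"

definition one_step_cost ::
    "('w, 'x, 's, 'a) bcr_mdp \<Rightarrow> ('s \<times> (real \<Rightarrow> real) \<Rightarrow> real) \<Rightarrow>
       's \<Rightarrow> (real \<Rightarrow> real) \<Rightarrow> 'a \<Rightarrow> 'x \<Rightarrow> real" where
  "one_step_cost M V s \<mu> a \<xi> =
     cost M s a \<xi> + discount M * V (trans_map M s a \<xi>, bayes_update M \<mu> \<xi>)"

abbreviation sb_dom :: "('w, 'x, 's, 'a) bcr_mdp \<Rightarrow> ('s \<times> (real \<Rightarrow> real)) set" where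
  "sb_dom M \<equiv> space (states M) \<times> space (beliefs M)"

(* Functions on S x D are represented extensionally, so that equality of two of them is equality
   of HOL functions. *)
definition bounded_measurable ::
    "('w, 'x, 's, 'a) bcr_mdp \<Rightarrow> ('s \<times> (real \<Rightarrow> real) \<Rightarrow> real) set" where
  "bounded_measurable M = {V \<in> borel_measurable (states M \<Otimes>\<^sub>M beliefs M).
     V \<in> extensional (sb_dom M) \<and> bounded (V ` sb_dom M)}"

definition bellman ::
    "('w, 'x, 's, 'a) bcr_mdp \<Rightarrow> ('s \<times> (real \<Rightarrow> real) \<Rightarrow> real) \<Rightarrow>
       ('s \<times> (real \<Rightarrow> real) \<Rightarrow> real)" where
  "bellman M V = (\<lambda>(s, \<mu>) \<in> sb_dom M.
     INF a \<in> actions M. composite_risk M \<mu> (one_step_cost M V s \<mu> a))"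

definition bellman_policy ::
    "('w, 'x, 's, 'a) bcr_mdp \<Rightarrow> ('s \<times> (real \<Rightarrow> real) \<Rightarrow> 'a) \<Rightarrow>
       ('s \<times> (real \<Rightarrow> real) \<Rightarrow> real) \<Rightarrow> ('s \<times> (real \<Rightarrow> real) \<Rightarrow> real)" where
  "bellman_policy M \<pi> V = (\<lambda>(s, \<mu>) \<in> sb_dom M.
     composite_risk M \<mu> (one_step_cost M V s \<mu> (\<pi> (s, \<mu>))))"

definition stationary_policies ::
    "('w, 'x, 's, 'a) bcr_mdp \<Rightarrow> ('s \<times> (real \<Rightarrow> real) \<Rightarrow> 'a) set" where
  "stationary_policies M = {\<pi> \<in> sb_dom M \<rightarrow> actions M.
     bellman_policy M \<pi> ` bounded_measurable M \<subseteq> bounded_measurable M}"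

(* The minimum in the Bellman operator is attained by a policy in stationary_policies, and not just
   at each point separately. If all maps from S x D to the action space are in stationary_policies,
   there is no difference. *)
definition bellman_well_defined :: "('w, 'x, 's, 'a) bcr_mdp \<Rightarrow> bool" where
  "bellman_well_defined M \<longleftrightarrow>
     (\<forall>V \<in> bounded_measurable M.
        (\<forall>s \<in> space (states M). \<forall>\<mu> \<in> space (beliefs M). \<forall>a \<in> actions M.
           composite_risk_defined M \<mu> (one_step_cost M V s \<mu> a)) \<and>
        (\<exists>\<pi> \<in> stationary_policies M.
           \<forall>s \<in> space (states M). \<forall>\<mu> \<in> space (beliefs M). \<forall>a \<in> actions M.
             composite_risk M \<mu> (one_step_cost M V s \<mu> (\<pi> (s, \<mu>)))
               \<le> composite_risk M \<mu> (one_step_cost M V s \<mu> a)) \<and>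
        bellman M V \<in> bounded_measurable M)"

primrec nested_value ::
    "('w, 'x, 's, 'a) bcr_mdp \<Rightarrow> ('s \<times> (real \<Rightarrow> real) \<Rightarrow> 'a) \<Rightarrow> nat \<Rightarrow>
       ('s \<times> (real \<Rightarrow> real) \<Rightarrow> real)" where
  "nested_value M \<pi> 0 = (\<lambda>_. 0)"
| "nested_value M \<pi> (Suc n) = (\<lambda>(s, \<mu>).
     composite_risk M \<mu> (one_step_cost M (nested_value M \<pi> n) s \<mu> (\<pi> (s, \<mu>))))"

definition policy_value ::
    "('w, 'x, 's, 'a) bcr_mdp \<Rightarrow> ('s \<times> (real \<Rightarrow> real) \<Rightarrow> 'a) \<Rightarrow> 's \<Rightarrow> (real \<Rightarrow> real) \<Rightarrow> real" where
  "policy_value M \<pi> s \<mu> = lim (\<lambda>n. nested_value M \<pi> n (s, \<mu>))"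

definition optimal_value ::
    "('w, 'x, 's, 'a) bcr_mdp \<Rightarrow> 's \<Rightarrow> (real \<Rightarrow> real) \<Rightarrow> real" where
  "optimal_value M s \<mu> = (INF \<pi> \<in> stationary_policies M. policy_value M \<pi> s \<mu>)"

end

theory Submission
  imports Defs
begin

text \<open>
  Both Bellman operators satisfy one inequality: if \<open>V \<le> W + c\<close> pointwise, for a real \<open>c\<close> of either
  sign, then \<open>T V \<le> T W + \<gamma> c\<close>. It contains the monotonicity of \<open>T\<close> and its
  contraction property, and everything about fixed points follows from it. If \<open>V \<le> T V\<close> and
  \<open>T W \<le> W\<close>, then \<open>V \<le> W + c\<close> improves to \<open>V \<le> W + \<gamma> c\<close>, so iteration gives \<open>V \<le> W\<close>
  (\<open>comparison\<close>); this yields uniqueness and the two bounds on \<open>V\<^sup>*\<close>. Existence comes from the uniform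
  convergence of the iterates (\<open>iteration_converges\<close>).

  The inequality comes from the monotonicity and translation invariance of the two risk measures. These
  are properties of random variables on the common probability space, ordered pointwise, whereas
  the composite risk sees only the laws of \<open>Z(\<xi>)\<close> and \<open>Y(\<theta>)\<close>, for which unrelated representatives
  are chosen. The gap is closed by a coupling: all laws are realised by their quantile functions
  applied to the same uniform variable. Pointwise order of two functions of \<open>\<xi>\<close> implies order of their
  quantile functions, hence pointwise order of these representatives, and law invariance
  makes the choice of representatives irrelevant (\<open>risk_at_law_shift\<close>). Applying this to the inner
  and then to the outer risk measure gives the inequality, provided that the next pair of state
  and belief is again in the domain on which \<open>V \<le> W + c\<close> is known (\<open>next_state_in_domain\<close>).

  For the optimal value, the nested values of a policy \<open>\<pi>\<close> are the iterates of its operator from \<open>0\<close>,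
  so the value of \<open>\<pi>\<close> is the fixed point \<open>V\<^sup>\<pi>\<close>. As \<open>T V\<^sup>\<pi> \<le> T\<^sup>\<pi> V\<^sup>\<pi> = V\<^sup>\<pi>\<close>, comparison gives
  \<open>V\<^sup>* \<le> V\<^sup>\<pi>\<close>. A policy that attains the minimum in \<open>T V\<^sup>*\<close> has \<open>V\<^sup>*\<close> as the fixed point of its operator,
  so its value is \<open>V\<^sup>*\<close> and the infimum over the policies is attained there.
\<close>

section \<open>Monotonicity of a risk measure as a function of the law\<close>

text \<open>The generalised inverse of the distribution function. A uniform variable on \<open>[0, 1]\<close> may take
  values outside \<open>(0, 1)\<close> on a null set, while the monotonicity of a risk measure asks for an
  inequality at every point; replacing such values by \<open>1 / 2\<close> keeps the comparison of
  two quantile functions valid there.\<close>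

definition quantile :: "real measure \<Rightarrow> real \<Rightarrow> real" where
  "quantile Q u = Inf {x. (if 0 < u \<and> u < 1 then u else 1 / 2) \<le> cdf Q x}"

lemma quantile_le_iff:
  assumes "real_distribution Q"
  shows "quantile Q u \<le> x \<longleftrightarrow> (if 0 < u \<and> u < 1 then u else 1 / 2) \<le> cdf Q x"
proof -
  interpret cdf_distribution Q
    using assms by (simp add: cdf_distribution_def)
  show ?thesis
    unfolding quantile_def by (rule pseudoinverse[symmetric]) auto
qed

lemma measurable_quantile:
  assumes "real_distribution Q"
  shows "quantile Q \<in> borel_measurable borel"
proof (rule borel_measurable_iff_le[THEN iffD2], rule allI)
  fix x
  have "{u. quantile Q u \<le> x} = {u. (if 0 < u \<and> u < 1 then u else 1 / 2) \<le> cdf Q x}"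
    using quantile_le_iff[OF assms] by simp
  also have "\<dots> \<in> sets borel"
    by measurable
  finally show "{u \<in> space borel. quantile Q u \<le> x} \<in> sets borel"
    by simp
qed

text \<open>Inverse transform sampling. The closed unit interval differs from the open one, where the inverse
  is taken without the default value, by two points of measure zero.\<close>

lemma distr_quantile:
  assumes Q: "real_distribution Q"
    and U: "U \<in> borel_measurable P" "distr P borel U = uniform_measure lborel {0..1}"
  shows "distr P borel (\<lambda>w. quantile Q (U w)) = Q"
proof -
  interpret cdf_distribution Q
    using Q by (simp add: cdf_distribution_def)
  note [measurable] = measurable_quantile[OF Q]
  have "distr P borel (\<lambda>w. quantile Q (U w)) = distr (distr P borel U) borel (quantile Q)"
    using U(1) by (subst distr_distr) (simp_all add: comp_def)
  also have "\<dots> = distr (restrict_space lborel {0<..<1}) borel (quantile Q)"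
  proof (rule measure_eqI)
    fix A assume "A \<in> sets (distr (distr P borel U) borel (quantile Q))"
    then have A [measurable]: "A \<in> sets borel" by simp
    have pre [measurable]: "quantile Q -` A \<in> sets borel"
      using measurable_sets[OF measurable_quantile[OF Q] A] by simp
    have "emeasure (uniform_measure lborel {0..1}) (quantile Q -` A)
        = emeasure lborel ({0..1} \<inter> quantile Q -` A)"
      by (simp add: emeasure_uniform_measure divide_ennreal_def)
    also have "\<dots> = emeasure lborel ({0<..<1} \<inter> quantile Q -` A)"
    proof (rule emeasure_eq_AE)
      show "AE u in lborel. u \<in> {0..1} \<inter> quantile Q -` A \<longleftrightarrow> u \<in> {0<..<1} \<inter> quantile Q -` A"
        using AE_lborel_singleton[of 0] AE_lborel_singleton[of 1] by eventually_elim auto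
    qed simp_all
    finally show "emeasure (distr (distr P borel U) borel (quantile Q)) A
        = emeasure (distr (restrict_space lborel {0<..<1}) borel (quantile Q)) A"
      unfolding U(2)
      by (simp add: emeasure_distr emeasure_restrict_space space_restrict_space
          measurable_restrict_space1 Int_commute)
  qed simp
  also have "\<dots> = distr (restrict_space lborel {0<..<1}) borel (\<lambda>u. Inf {x. u \<le> cdf Q x})"
    by (rule distr_cong) (auto simp: space_restrict_space quantile_def)
  also have "\<dots> = Q"
    by (rule distr_I_eq_M)
  finally show ?thesis .
qed

text \<open>The coupling preserves order: if \<open>X \<le> Y + c\<close>, the distribution function of \<open>X\<close> at \<open>y + c\<close> is
  at least that of \<open>Y\<close> at \<open>y\<close>, and the Galois connection \<open>quantile_le_iff\<close> turns this into a comparison of the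
  quantiles.\<close>

lemma quantile_shift:
  assumes N: "prob_space N"
    and X: "X \<in> borel_measurable N" and Y: "Y \<in> borel_measurable N"
    and le: "\<And>x. x \<in> space N \<Longrightarrow> X x \<le> Y x + c"
  shows "quantile (distr N borel X) u \<le> quantile (distr N borel Y) u + c"
proof -
  interpret prob_space N by (rule N)
  let ?y = "quantile (distr N borel Y) u"
  have "cdf (distr N borel Y) ?y \<le> cdf (distr N borel X) (?y + c)"
  proof -
    have "Y -` {..?y} \<inter> space N \<subseteq> X -` {..?y + c} \<inter> space N"
      using le by force
    with X Y show ?thesis
      unfolding cdf_def by (simp add: measure_distr finite_measure_mono)
  qed
  moreover have "(if 0 < u \<and> u < 1 then u else 1 / 2) \<le> cdf (distr N borel Y) ?y"
    using quantile_le_iff[of "distr N borel Y" u ?y] Y by simp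
  ultimately show ?thesis
    using quantile_le_iff[of "distr N borel X" u "?y + c"] X by simp
qed

text \<open>Membership in \<open>L\<^sup>p\<close> is a property of the law alone, so that the quantile representative of an \<open>L\<^sup>p\<close>
  variable on another probability space is an admissible argument of the risk measure.\<close>

lemma Lp_space_cong_distr:
  assumes "X \<in> borel_measurable N" "Y \<in> borel_measurable P"
    and "distr N borel X = distr P borel Y"
  shows "X \<in> Lp_space N p \<longleftrightarrow> Y \<in> Lp_space P p"
proof -
  have "(AE w in N. \<bar>X w\<bar> \<le> c) \<longleftrightarrow> (AE w in P. \<bar>Y w\<bar> \<le> c)" for c
    using AE_distr_iff[OF assms(1), of "\<lambda>x. \<bar>x\<bar> \<le> c"]
      AE_distr_iff[OF assms(2), of "\<lambda>x. \<bar>x\<bar> \<le> c"] unfolding assms(3) by simp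
  moreover have "integrable N (\<lambda>w. \<bar>X w\<bar> powr r) \<longleftrightarrow> integrable P (\<lambda>w. \<bar>Y w\<bar> powr r)" for r
    using integrable_distr_eq[OF assms(1), of "\<lambda>x. \<bar>x\<bar> powr r"]
      integrable_distr_eq[OF assms(2), of "\<lambda>x. \<bar>x\<bar> powr r"] assms(3) by simp
  ultimately show ?thesis
    using assms(1,2) by (simp add: Lp_space_def)
qed

lemma abs_add_powr_le:
  fixes x y r :: real
  assumes "0 \<le> r"
  shows "\<bar>x + y\<bar> powr r \<le> 2 powr r * (\<bar>x\<bar> powr r + \<bar>y\<bar> powr r)"
proof -
  have "\<bar>x + y\<bar> powr r \<le> (2 * max \<bar>x\<bar> \<bar>y\<bar>) powr r"
    using assms by (intro powr_mono2) auto
  also have "\<dots> = 2 powr r * max \<bar>x\<bar> \<bar>y\<bar> powr r"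
    by (simp add: powr_mult)
  also have "\<dots> \<le> 2 powr r * (\<bar>x\<bar> powr r + \<bar>y\<bar> powr r)"
    by (intro mult_left_mono) (auto simp: max_def)
  finally show ?thesis .
qed

lemma Lp_space_add_const:
  assumes "prob_space P" and X: "X \<in> Lp_space P p"
  shows "(\<lambda>w. X w + c) \<in> Lp_space P p"
proof -
  interpret prob_space P by fact
  have [measurable]: "X \<in> borel_measurable P"
    using X by (simp add: Lp_space_def)
  show ?thesis
  proof (cases "p = \<infinity>")
    case True
    with X obtain b where "AE w in P. \<bar>X w\<bar> \<le> b"
      by (auto simp: Lp_space_def)
    then have "AE w in P. \<bar>X w + c\<bar> \<le> b + \<bar>c\<bar>"
      by eventually_elim linarith
    with True show ?thesis
      by (auto simp: Lp_space_def)
  next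
    case False
    with X have "integrable P (\<lambda>w. 2 powr enn2real p * (\<bar>X w\<bar> powr enn2real p + \<bar>c\<bar> powr enn2real p))"
      by (simp add: Lp_space_def)
    then have "integrable P (\<lambda>w. \<bar>X w + c\<bar> powr enn2real p)"
      by (rule Bochner_Integration.integrable_bound) (auto intro!: AE_I2 abs_add_powr_le)
    with False show ?thesis
      by (simp add: Lp_space_def)
  qed
qed

lemma risk_at_law_eq:
  assumes "law_invariant P p \<rho>" and "X \<in> Lp_space P p"
  shows "risk_at_law P p \<rho> (distr P borel X) = \<rho> X"
proof -
  let ?Y = "SOME Y. Y \<in> Lp_space P p \<and> distr P borel Y = distr P borel X"
  have "?Y \<in> Lp_space P p \<and> distr P borel ?Y = distr P borel X"
    by (rule someI[of _ X]) (simp add: assms)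
  with assms show ?thesis
    unfolding risk_at_law_def law_invariant_def by blast
qed

text \<open>Monotonicity and translation invariance pass from random variables to laws. The two variables live
  on a space \<open>N\<close> unrelated to the domain \<open>P\<close> of the risk measure; replacing both by quantile
  functions of the same \<open>U\<close> transports their order to \<open>P\<close>.\<close>

lemma risk_at_law_shift:
  fixes U :: "'w \<Rightarrow> real"
  assumes P: "prob_space P"
    and U: "U \<in> borel_measurable P" "distr P borel U = uniform_measure lborel {0..1}"
    and \<rho>: "monetary_risk_measure P p \<rho>" "law_invariant P p \<rho>"
    and N: "prob_space N"
    and X: "X \<in> Lp_space N p" and Y: "Y \<in> Lp_space N p"
    and le: "\<And>x. x \<in> space N \<Longrightarrow> X x \<le> Y x + c"
  shows "risk_at_law P p \<rho> (distr N borel X) \<le> risk_at_law P p \<rho> (distr N borel Y) + c"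
proof -
  interpret N: prob_space N by (rule N)
  define q where "q Z w = quantile (distr N borel Z) (U w)" for Z w
  have transfer: "distr P borel (q Z) = distr N borel Z" "q Z \<in> Lp_space P p"
    if Z: "Z \<in> Lp_space N p" for Z
  proof -
    have Zm: "Z \<in> borel_measurable N"
      using Z by (simp add: Lp_space_def)
    then have Q: "real_distribution (distr N borel Z)"
      by simp
    show "distr P borel (q Z) = distr N borel Z"
      unfolding q_def by (rule distr_quantile[OF Q U])
    moreover have "q Z \<in> borel_measurable P"
      unfolding q_def using measurable_quantile[OF Q] U(1) by simp
    ultimately show "q Z \<in> Lp_space P p"
      using Lp_space_cong_distr[of "q Z" P Z N p] Zm Z by simp
  qed
  have "\<rho> (q X) \<le> \<rho> (\<lambda>w. q Y w + c)"
  proof -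
    have "q X w \<le> q Y w + c" for w
      unfolding q_def using X Y
      by (intro quantile_shift[OF N _ _ le]) (auto simp: Lp_space_def)
    then show ?thesis
      using \<rho>(1) transfer(2)[OF X] Lp_space_add_const[OF P transfer(2)[OF Y], of c]
      unfolding monetary_risk_measure_def by simp
  qed
  also have "\<dots> = \<rho> (q Y) + c"
    using \<rho>(1) transfer(2)[OF Y] unfolding monetary_risk_measure_def by blast
  finally show ?thesis
    using risk_at_law_eq[OF \<rho>(2) transfer(2)[OF X]] risk_at_law_eq[OF \<rho>(2) transfer(2)[OF Y]]
    by (simp add: transfer(1) X Y)
qed

section \<open>The composite risk of a one-step cost\<close>

lemma lik_measurable:
  assumes "is_bcr_mdp M" and "\<theta> \<in> params M"
  shows "lik M \<theta> \<in> borel_measurable (noise M)"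
  using assms measurable_Pair2[of "case_prod (lik M)" "restrict_space borel (params M)" "noise M" borel \<theta>]
  by (simp add: is_bcr_mdp_def space_restrict_space)

lemma prob_space_model_law:
  assumes "is_bcr_mdp M" and "\<theta> \<in> params M"
  shows "prob_space (model_law M \<theta>)"
  using assms lik_measurable[OF assms]
  by (auto simp: is_bcr_mdp_def model_law_def emeasure_density intro!: prob_spaceI cong: nn_integral_cong)

lemma prob_space_belief_law:
  assumes "is_bcr_mdp M" and "\<mu> \<in> prob_densities (params M)"
  shows "prob_space (belief_law M \<mu>)"
proof (rule prob_spaceI)
  have [measurable]: "params M \<in> sets borel" "\<mu> \<in> borel_measurable borel"
    using assms by (auto simp: is_bcr_mdp_def prob_densities_def)
  have "(\<integral>\<^sup>+ \<theta>. ennreal (\<mu> \<theta>) \<partial>restrict_space lborel (params M)) = (\<integral>\<^sup>+ \<theta>. ennreal (\<mu> \<theta>) \<partial>lborel)"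
  proof (subst nn_integral_restrict_space)
    show "(\<integral>\<^sup>+ \<theta>. ennreal (\<mu> \<theta>) * indicator (params M) \<theta> \<partial>lborel) = (\<integral>\<^sup>+ \<theta>. ennreal (\<mu> \<theta>) \<partial>lborel)"
      using assms(2) by (intro nn_integral_cong) (auto simp: prob_densities_def indicator_def)
  qed simp
  also have "\<dots> = 1"
    using assms(2) by (simp add: prob_densities_def)
  finally have "(\<integral>\<^sup>+ \<theta>. ennreal (\<mu> \<theta>) \<partial>restrict_space lborel (params M)) = 1" .
  moreover have "(\<integral>\<^sup>+ \<theta>. ennreal (\<mu> \<theta>) * indicator (space (restrict_space lborel (params M))) \<theta>
      \<partial>restrict_space lborel (params M))
    = (\<integral>\<^sup>+ \<theta>. ennreal (\<mu> \<theta>) \<partial>restrict_space lborel (params M))"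
    by (intro nn_integral_cong) simp
  ultimately show "emeasure (belief_law M \<mu>) (space (belief_law M \<mu>)) = 1"
    unfolding belief_law_def space_density
    by (subst emeasure_density[OF _ sets.top]) (simp_all add: measurable_restrict_space1)
qed

text \<open>Two applications of \<open>risk_at_law_shift\<close>: the inner one gives the same inequality between the
  inner values at every parameter, which is the hypothesis of the outer one.\<close>

lemma composite_risk_shift:
  fixes M :: "('w, 'x, 's, 'a :: real_normed_vector) bcr_mdp"
  assumes M: "is_bcr_mdp M" and \<mu>: "\<mu> \<in> space (beliefs M)"
    and Z: "composite_risk_defined M \<mu> Z" and W: "composite_risk_defined M \<mu> W"
    and le: "\<And>\<xi>. \<xi> \<in> space (noise M) \<Longrightarrow> Z \<xi> \<le> W \<xi> + c"
  shows "composite_risk M \<mu> Z \<le> composite_risk M \<mu> W + c"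
proof -
  obtain U :: "'w \<Rightarrow> real" where U: "U \<in> borel_measurable (probsp M)"
      "distr (probsp M) borel U = uniform_measure lborel {0..1}"
    using M unfolding is_bcr_mdp_def by blast
  have P: "prob_space (probsp M)"
    and inner: "monetary_risk_measure (probsp M) (p_exp M) (inner_risk M)"
      "law_invariant (probsp M) (p_exp M) (inner_risk M)"
    and outer: "monetary_risk_measure (probsp M) (p_exp M) (outer_risk M)"
      "law_invariant (probsp M) (p_exp M) (outer_risk M)"
    and \<mu>': "\<mu> \<in> prob_densities (params M)"
    using M \<mu> by (simp_all add: is_bcr_mdp_def)
  have "inner_value M Z \<theta> \<le> inner_value M W \<theta> + c" if "\<theta> \<in> params M" for \<theta>
    unfolding inner_value_def using that Z W le
    by (intro risk_at_law_shift[OF P U inner prob_space_model_law[OF M that]])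
       (auto simp: composite_risk_defined_def model_law_def)
  then show ?thesis
    unfolding composite_risk_def outer_value_def using Z W
    by (intro risk_at_law_shift[OF P U outer prob_space_belief_law[OF M \<mu>']])
       (auto simp: composite_risk_defined_def belief_law_def space_restrict_space)
qed

text \<open>The nested values are total functions that are not extensional; off the domain they differ from the
  iterates of the Bellman operator, but such values never enter the composite risk.\<close>

lemma composite_risk_cong:
  assumes "\<And>\<xi>. \<xi> \<in> space (noise M) \<Longrightarrow> Z \<xi> = W \<xi>"
  shows "composite_risk M \<mu> Z = composite_risk M \<mu> W"
proof -
  have "distr (model_law M \<theta>) borel Z = distr (model_law M \<theta>) borel W" for \<theta>
    using assms by (intro distr_cong) (auto simp: model_law_def)
  then have "inner_value M Z = inner_value M W"
    by (simp add: inner_value_def fun_eq_iff)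
  then show ?thesis
    by (simp add: composite_risk_def)
qed

text \<open>A positive normalising integral \<open>Z\<close> is in particular the integral of an integrable function, since the
  Bochner integral of any other function is \<open>0\<close>. This yields both the measurability of the
  posterior and its total mass \<open>1\<close>.\<close>

lemma bayes_update_in_beliefs:
  assumes M: "is_bcr_mdp M" and \<mu>: "\<mu> \<in> space (beliefs M)" and \<xi>: "\<xi> \<in> space (noise M)"
  shows "bayes_update M \<mu> \<xi> \<in> space (beliefs M)"
proof -
  define Z where "Z = (LBINT \<theta>:params M. lik M \<theta> \<xi> * \<mu> \<theta>)"
  have sp: "space (beliefs M) = prob_densities (params M)"
    using M by (simp add: is_bcr_mdp_def)
  show ?thesis
  proof (cases "Z > 0")
    case False
    then show ?thesis
      using \<mu> by (simp add: bayes_update_def Z_def[symmetric])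
  next
    case True
    have \<mu>m [measurable]: "\<mu> \<in> borel_measurable borel" and \<mu>0: "\<And>\<theta>. 0 \<le> \<mu> \<theta>"
      and off: "\<And>\<theta>. \<theta> \<notin> params M \<Longrightarrow> \<mu> \<theta> = 0"
      using \<mu> by (auto simp: sp prob_densities_def)
    have \<Theta> [measurable]: "params M \<in> sets borel"
      and lik0: "\<And>\<theta>. \<theta> \<in> params M \<Longrightarrow> 0 \<le> lik M \<theta> \<xi>"
      using M \<xi> by (auto simp: is_bcr_mdp_def)
    let ?f = "\<lambda>\<theta>. lik M \<theta> \<xi> * \<mu> \<theta>"
    have Z: "Z = (\<integral>\<theta>. ?f \<theta> \<partial>lborel)"
      unfolding Z_def set_lebesgue_integral_def
      using off by (intro Bochner_Integration.integral_cong) (auto simp: indicator_def)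
    have nonneg: "0 \<le> ?f \<theta>" for \<theta>
      using lik0 \<mu>0 off by (cases "\<theta> \<in> params M") auto
    have int: "integrable lborel ?f"
      using True not_integrable_integral_eq[of lborel ?f] unfolding Z by fastforce
    have "(\<integral>\<^sup>+ \<theta>. ennreal (?f \<theta> / Z) \<partial>lborel) = ennreal (\<integral>\<theta>. ?f \<theta> / Z \<partial>lborel)"
      using int True nonneg by (intro nn_integral_eq_integral) auto
    also have "\<dots> = 1"
      using True Z by simp
    finally have total: "(\<integral>\<^sup>+ \<theta>. ennreal (?f \<theta> / Z) \<partial>lborel) = 1" .
    have "?f \<in> borel_measurable borel"
      using int by (simp add: borel_measurable_integrable)
    with total True nonneg off have "(\<lambda>\<theta>. ?f \<theta> / Z) \<in> prob_densities (params M)"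
      by (auto simp: prob_densities_def)
    with True show ?thesis
      by (simp add: bayes_update_def Z_def[symmetric] sp)
  qed
qed

lemma next_state_in_domain:
  assumes "is_bcr_mdp M" and "(s, \<mu>) \<in> sb_dom M" and "a \<in> actions M" and "\<xi> \<in> space (noise M)"
  shows "(trans_map M s a \<xi>, bayes_update M \<mu> \<xi>) \<in> sb_dom M"
  using assms bayes_update_in_beliefs[OF assms(1)] by (auto simp: is_bcr_mdp_def)

lemma composite_risk_one_step_shift:
  assumes M: "is_bcr_mdp M" "bellman_well_defined M" and "0 \<le> discount M"
    and V: "V \<in> bounded_measurable M" and W: "W \<in> bounded_measurable M"
    and le: "\<And>x. x \<in> sb_dom M \<Longrightarrow> V x \<le> W x + c"
    and s: "(s, \<mu>) \<in> sb_dom M" and a: "a \<in> actions M"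
  shows "composite_risk M \<mu> (one_step_cost M V s \<mu> a)
    \<le> composite_risk M \<mu> (one_step_cost M W s \<mu> a) + discount M * c"
proof (rule composite_risk_shift[OF M(1)])
  show "\<mu> \<in> space (beliefs M)"
    using s by simp
  show "composite_risk_defined M \<mu> (one_step_cost M V s \<mu> a)"
    "composite_risk_defined M \<mu> (one_step_cost M W s \<mu> a)"
    using M(2) V W s a unfolding bellman_well_defined_def by auto
  fix \<xi> assume "\<xi> \<in> space (noise M)"
  then have "discount M * V (trans_map M s a \<xi>, bayes_update M \<mu> \<xi>)
      \<le> discount M * (W (trans_map M s a \<xi>, bayes_update M \<mu> \<xi>) + c)"
    using next_state_in_domain[OF M(1) s a] le \<open>0 \<le> discount M\<close> by (intro mult_left_mono) auto
  then show "one_step_cost M V s \<mu> a \<xi> \<le> one_step_cost M W s \<mu> a \<xi> + discount M * c"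
    by (simp add: one_step_cost_def algebra_simps)
qed

section \<open>Fixed points of operators that discount constants\<close>

definition bounded_on_space :: "'b measure \<Rightarrow> ('b \<Rightarrow> real) set" where
  "bounded_on_space N =
     {V \<in> borel_measurable N. V \<in> extensional (space N) \<and> bounded (V ` space N)}"

lemma bounded_on_space_gap:
  assumes "V \<in> bounded_on_space N" and "W \<in> bounded_on_space N"
  obtains c where "\<And>x. x \<in> space N \<Longrightarrow> \<bar>V x - W x\<bar> \<le> c"
proof -
  obtain b where b: "\<forall>y \<in> V ` space N. norm y \<le> b"
    using assms(1) unfolding bounded_on_space_def bounded_iff by blast
  obtain d where d: "\<forall>y \<in> W ` space N. norm y \<le> d"
    using assms(2) unfolding bounded_on_space_def bounded_iff by blast
  have "\<bar>V x - W x\<bar> \<le> \<bar>b\<bar> + \<bar>d\<bar>" if "x \<in> space N" for x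
  proof -
    have "\<bar>V x\<bar> \<le> b" "\<bar>W x\<bar> \<le> d"
      using b d that by simp_all
    then show ?thesis by linarith
  qed
  then show thesis
    by (rule that)
qed

lemma bounded_on_space_uniform_limit:
  assumes f: "\<And>n. f n \<in> bounded_on_space N" and lim: "uniform_limit (space N) f F sequentially"
    and F: "F \<in> extensional (space N)"
  shows "F \<in> bounded_on_space N"
proof -
  have "F \<in> borel_measurable N"
  proof (rule borel_measurable_LIMSEQ_real[of N f])
    show "(\<lambda>n. f n x) \<longlonglongrightarrow> F x" if "x \<in> space N" for x
      using tendsto_uniform_limitI[OF lim that] .
    show "f n \<in> borel_measurable N" for n
      using f[of n] by (simp add: bounded_on_space_def)
  qed
  moreover have "bounded (F ` space N)"
  proof -
    obtain n where n: "\<forall>x \<in> space N. dist (f n x) (F x) < 1"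
      using eventually_happens'[OF sequentially_bot uniform_limitD[OF lim zero_less_one]] ..
    obtain b where b: "\<forall>y \<in> f n ` space N. norm y \<le> b"
      using f[of n] unfolding bounded_on_space_def bounded_iff by blast
    have "\<bar>F x\<bar> \<le> b + 1" if "x \<in> space N" for x
    proof -
      have "\<bar>f n x\<bar> \<le> b" "\<bar>f n x - F x\<bar> < 1"
        using n b that by (simp_all add: dist_real_def)
      then show ?thesis by linarith
    qed
    then show ?thesis
      unfolding bounded_iff by (intro exI[of _ "b + 1"]) simp
  qed
  ultimately show ?thesis
    using F by (simp add: bounded_on_space_def)
qed

text \<open>The constant \<open>c\<close> in \<open>shift\<close> may be negative. Blackwell's conditions of monotonicity and
  discounting are the cases \<open>c = 0\<close> and \<open>V = W + c\<close>; a single inequality spares the detour through the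
  function \<open>W + c\<close>, which would have to be restricted to the domain first.\<close>

locale discounting_operator =
  fixes N :: "'b measure" and T :: "('b \<Rightarrow> real) \<Rightarrow> ('b \<Rightarrow> real)" and \<gamma> :: real
  assumes \<gamma>: "0 \<le> \<gamma>" "\<gamma> < 1"
    and maps: "\<And>V. V \<in> bounded_on_space N \<Longrightarrow> T V \<in> bounded_on_space N"
    and shift: "\<And>V W c x. V \<in> bounded_on_space N \<Longrightarrow> W \<in> bounded_on_space N \<Longrightarrow>
      (\<And>y. y \<in> space N \<Longrightarrow> V y \<le> W y + c) \<Longrightarrow> x \<in> space N \<Longrightarrow> T V x \<le> T W x + \<gamma> * c"
begin

lemma iterate_maps: "V \<in> bounded_on_space N \<Longrightarrow> (T ^^ n) V \<in> bounded_on_space N"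
  by (induction n) (auto intro: maps)

lemma contraction:
  assumes "V \<in> bounded_on_space N" "W \<in> bounded_on_space N"
    and "\<And>y. y \<in> space N \<Longrightarrow> \<bar>V y - W y\<bar> \<le> c" and "x \<in> space N"
  shows "\<bar>T V x - T W x\<bar> \<le> \<gamma> * c"
proof -
  have "V y \<le> W y + c" "W y \<le> V y + c" if "y \<in> space N" for y
    using assms(3)[OF that] by auto
  then show ?thesis
    using shift[OF assms(1,2) _ assms(4), of c] shift[OF assms(2,1) _ assms(4), of c] by force
qed

text \<open>A subsolution lies below a supersolution: each application of \<open>T\<close> shrinks the a priori
  bound \<open>c\<close> on their difference by the factor \<open>\<gamma>\<close>.\<close>

lemma comparison:
  assumes V: "V \<in> bounded_on_space N" and W: "W \<in> bounded_on_space N"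
    and sub: "\<And>x. x \<in> space N \<Longrightarrow> V x \<le> T V x"
    and super: "\<And>x. x \<in> space N \<Longrightarrow> T W x \<le> W x"
    and x: "x \<in> space N"
  shows "V x \<le> W x"
proof -
  obtain c where c: "\<And>x. x \<in> space N \<Longrightarrow> \<bar>V x - W x\<bar> \<le> c"
    using bounded_on_space_gap[OF V W] by blast
  have "V x \<le> W x + \<gamma> ^ n * c" if "x \<in> space N" for n x
    using that
  proof (induction n arbitrary: x)
    case 0
    then show ?case using c[of x] by simp
  next
    case (Suc n)
    have "V x \<le> T V x"
      using sub Suc.prems .
    also have "\<dots> \<le> T W x + \<gamma> * (\<gamma> ^ n * c)"
      using shift[OF V W Suc.IH Suc.prems] .
    also have "\<dots> \<le> W x + \<gamma> * (\<gamma> ^ n * c)"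
      using super[OF Suc.prems] by simp
    finally show ?case by (simp add: mult.assoc)
  qed
  moreover have "(\<lambda>n. W x + \<gamma> ^ n * c) \<longlonglongrightarrow> W x + 0 * c"
    using \<gamma> by (intro tendsto_intros LIMSEQ_power_zero) simp
  ultimately show ?thesis
    using x by (intro LIMSEQ_le_const[of "\<lambda>n. W x + \<gamma> ^ n * c"]) auto
qed

lemma fixed_point_unique:
  assumes "V \<in> bounded_on_space N" "T V = V" and "W \<in> bounded_on_space N" "T W = W"
  shows "V = W"
proof (rule extensionalityI)
  show "V \<in> extensional (space N)" "W \<in> extensional (space N)"
    using assms by (auto simp: bounded_on_space_def)
  show "V x = W x" if "x \<in> space N" for x
    using comparison[of V W x] comparison[of W V x] assms that by auto
qed

text \<open>The increments of the iteration are dominated by a geometric series, so the iterates converge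
  uniformly. The contraction property then shows that the sequence \<open>T\<^sup>n\<^sup>+\<^sup>1 V\<close> converges to \<open>T F\<close> as well as to \<open>F\<close>.\<close>

lemma iteration_converges:
  assumes V: "V \<in> bounded_on_space N"
  obtains F where "F \<in> bounded_on_space N" and "T F = F"
    and "\<And>x. x \<in> space N \<Longrightarrow> (\<lambda>n. (T ^^ n) V x) \<longlonglongrightarrow> F x"
proof -
  obtain c where c: "\<And>x. x \<in> space N \<Longrightarrow> \<bar>T V x - V x\<bar> \<le> c"
    using bounded_on_space_gap[OF maps[OF V] V] by blast
  have step: "\<bar>(T ^^ Suc n) V x - (T ^^ n) V x\<bar> \<le> \<gamma> ^ n * c" if "x \<in> space N" for n x
    using that
  proof (induction n arbitrary: x)
    case 0
    then show ?case using c by simp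
  next
    case (Suc n)
    show ?case
      using contraction[OF iterate_maps[OF V] iterate_maps[OF V] Suc.IH Suc.prems]
      by (simp add: mult.assoc)
  qed
  have "uniform_limit (space N) (\<lambda>n x. \<Sum>i<n. (T ^^ Suc i) V x - (T ^^ i) V x)
      (\<lambda>x. \<Sum>i. (T ^^ Suc i) V x - (T ^^ i) V x) sequentially"
    using step \<gamma> by (intro Weierstrass_m_test[where M = "\<lambda>n. \<gamma> ^ n * c"])
      (auto intro!: summable_mult2 summable_geometric)
  then have series: "uniform_limit (space N) (\<lambda>n x. (T ^^ n) V x - V x)
      (\<lambda>x. \<Sum>i. (T ^^ Suc i) V x - (T ^^ i) V x) sequentially"
    by (subst (asm) sum_lessThan_telescope) simp
  define F where "F = (\<lambda>x \<in> space N. V x + (\<Sum>i. (T ^^ Suc i) V x - (T ^^ i) V x))"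
  have lim: "uniform_limit (space N) (\<lambda>n. (T ^^ n) V) F sequentially"
    using uniform_limit_add[OF uniform_limit_const[of V] series]
    by (rule uniform_limit_cong'[THEN iffD1, rotated -1]) (auto simp: F_def)
  have F: "F \<in> bounded_on_space N"
    by (rule bounded_on_space_uniform_limit[OF iterate_maps[OF V] lim]) (simp add: F_def)
  have pointwise: "(\<lambda>n. (T ^^ n) V x) \<longlonglongrightarrow> F x" if "x \<in> space N" for x
    using tendsto_uniform_limitI[OF lim that] .
  have "(\<lambda>n. (T ^^ Suc n) V x) \<longlonglongrightarrow> T F x" if x: "x \<in> space N" for x
  proof (rule tendstoI)
    fix e :: real assume "e > 0"
    have "\<forall>\<^sub>F n in sequentially. \<forall>y\<in>space N. dist ((T ^^ n) V y) (F y) < e"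
      using uniform_limitD[OF lim \<open>e > 0\<close>] .
    then show "\<forall>\<^sub>F n in sequentially. dist ((T ^^ Suc n) V x) (T F x) < e"
    proof eventually_elim
      case (elim n)
      then have "\<bar>T ((T ^^ n) V) x - T F x\<bar> \<le> \<gamma> * e"
        by (intro contraction[OF iterate_maps[OF V] F _ x]) (auto simp: dist_real_def less_imp_le)
      also have "\<dots> < e"
        using \<gamma> \<open>e > 0\<close> by simp
      finally show ?case
        by (simp add: dist_real_def)
    qed
  qed
  then have "T F x = F x" if "x \<in> space N" for x
    using LIMSEQ_unique LIMSEQ_Suc[OF pointwise[OF that]] that by blast
  then have "T F = F"
    using F maps[OF F] by (intro extensionalityI[of _ "space N"]) (auto simp: bounded_on_space_def)
  then show thesis
    using that F pointwise by blast
qed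

end

section \<open>The Bellman operators and the optimal value\<close>

lemma bounded_measurable_eq:
  "bounded_measurable M = bounded_on_space (states M \<Otimes>\<^sub>M beliefs M)"
  by (simp add: bounded_measurable_def bounded_on_space_def space_pair_measure)

lemma zero_in_bounded_measurable: "(\<lambda>x \<in> sb_dom M. 0) \<in> bounded_measurable M"
proof -
  have "(\<lambda>x \<in> sb_dom M. 0 :: real) \<in> borel_measurable (states M \<Otimes>\<^sub>M beliefs M)"
    by (subst measurable_cong[where g = "\<lambda>_. 0"]) (auto simp: space_pair_measure)
  then show ?thesis
    by (auto simp: bounded_measurable_def bounded_iff)
qed

lemma policy_action:
  assumes "\<pi> \<in> stationary_policies M" and "(s, \<mu>) \<in> sb_dom M"
  shows "\<pi> (s, \<mu>) \<in> actions M"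
  using assms unfolding stationary_policies_def by blast

text \<open>Attainment of the minimum serves to bound the infimum in the Bellman operator from below;
  the infimum of a set of reals without a lower bound would be a meaningless value.\<close>

lemma bellman_le:
  assumes M: "bellman_well_defined M" and V: "V \<in> bounded_measurable M"
    and s: "(s, \<mu>) \<in> sb_dom M" and a: "a \<in> actions M"
  shows "bellman M V (s, \<mu>) \<le> composite_risk M \<mu> (one_step_cost M V s \<mu> a)"
proof -
  obtain \<pi> where "\<forall>a \<in> actions M. composite_risk M \<mu> (one_step_cost M V s \<mu> (\<pi> (s, \<mu>)))
      \<le> composite_risk M \<mu> (one_step_cost M V s \<mu> a)"
    using M V s unfolding bellman_well_defined_def by blast
  then have "bdd_below ((\<lambda>a. composite_risk M \<mu> (one_step_cost M V s \<mu> a)) ` actions M)"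
    by (auto intro!: bdd_belowI2)
  then show ?thesis
    using s a cINF_lower[of "\<lambda>a. composite_risk M \<mu> (one_step_cost M V s \<mu> a)" "actions M" a]
    by (simp add: bellman_def)
qed

lemma minimizing_policy:
  assumes M: "bellman_well_defined M" and V: "V \<in> bounded_measurable M"
  obtains \<pi> where "\<pi> \<in> stationary_policies M" and "bellman_policy M \<pi> V = bellman M V"
proof -
  obtain \<pi> where \<pi>: "\<pi> \<in> stationary_policies M"
    and min: "\<And>s \<mu> a. (s, \<mu>) \<in> sb_dom M \<Longrightarrow> a \<in> actions M \<Longrightarrow>
      composite_risk M \<mu> (one_step_cost M V s \<mu> (\<pi> (s, \<mu>)))
        \<le> composite_risk M \<mu> (one_step_cost M V s \<mu> a)"
    using M V unfolding bellman_well_defined_def by blast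
  have "bellman_policy M \<pi> V (s, \<mu>) = bellman M V (s, \<mu>)" if s: "(s, \<mu>) \<in> sb_dom M" for s \<mu>
  proof (rule antisym)
    have "composite_risk M \<mu> (one_step_cost M V s \<mu> (\<pi> (s, \<mu>)))
        \<le> (INF a \<in> actions M. composite_risk M \<mu> (one_step_cost M V s \<mu> a))"
      using policy_action[OF \<pi> s] min[OF s] by (intro cINF_greatest) auto
    then show "bellman_policy M \<pi> V (s, \<mu>) \<le> bellman M V (s, \<mu>)"
      using s by (simp add: bellman_policy_def bellman_def)
    show "bellman M V (s, \<mu>) \<le> bellman_policy M \<pi> V (s, \<mu>)"
      using bellman_le[OF M V s policy_action[OF \<pi> s]] s by (simp add: bellman_policy_def)
  qed
  then have "bellman_policy M \<pi> V = bellman M V"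
    by (intro extensionalityI[of _ "sb_dom M"]) (auto simp: bellman_policy_def bellman_def)
  with \<pi> show thesis
    by (rule that)
qed

lemma discounting_bellman_policy:
  assumes M: "is_bcr_mdp M" "bellman_well_defined M" and \<gamma>: "0 \<le> discount M" "discount M < 1"
    and \<pi>: "\<pi> \<in> stationary_policies M"
  shows "discounting_operator (states M \<Otimes>\<^sub>M beliefs M) (bellman_policy M \<pi>) (discount M)"
proof (unfold_locales, fold bounded_measurable_eq)
  fix V W c x
  assume V: "V \<in> bounded_measurable M" and W: "W \<in> bounded_measurable M"
    and le: "\<And>y. y \<in> space (states M \<Otimes>\<^sub>M beliefs M) \<Longrightarrow> V y \<le> W y + c"
    and x: "x \<in> space (states M \<Otimes>\<^sub>M beliefs M)"
  obtain s \<mu> where s: "x = (s, \<mu>)" "(s, \<mu>) \<in> sb_dom M"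
    using x by (cases x) (auto simp: space_pair_measure)
  show "bellman_policy M \<pi> V x \<le> bellman_policy M \<pi> W x + discount M * c"
    using composite_risk_one_step_shift[OF M \<gamma>(1) V W _ s(2) policy_action[OF \<pi> s(2)], of c] le s
    by (simp add: bellman_policy_def space_pair_measure)
qed (use \<pi> \<gamma> in \<open>auto simp: stationary_policies_def\<close>)

text \<open>The minimum inherits the inequality from the policies: a policy \<open>\<pi>\<close> that minimises for \<open>W\<close> satisfies
  \<open>T V \<le> T\<^sup>\<pi> V \<le> T\<^sup>\<pi> W + \<gamma> c = T W + \<gamma> c\<close>.\<close>

lemma discounting_bellman:
  assumes M: "is_bcr_mdp M" "bellman_well_defined M" and \<gamma>: "0 \<le> discount M" "discount M < 1"
  shows "discounting_operator (states M \<Otimes>\<^sub>M beliefs M) (bellman M) (discount M)"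
proof (unfold_locales, fold bounded_measurable_eq)
  fix V W c x
  assume V: "V \<in> bounded_measurable M" and W: "W \<in> bounded_measurable M"
    and le: "\<And>y. y \<in> space (states M \<Otimes>\<^sub>M beliefs M) \<Longrightarrow> V y \<le> W y + c"
    and x: "x \<in> space (states M \<Otimes>\<^sub>M beliefs M)"
  obtain s \<mu> where s: "x = (s, \<mu>)" "(s, \<mu>) \<in> sb_dom M"
    using x by (cases x) (auto simp: space_pair_measure)
  obtain \<pi> where \<pi>: "\<pi> \<in> stationary_policies M" "bellman_policy M \<pi> W = bellman M W"
    using minimizing_policy[OF M(2) W] .
  interpret \<pi>: discounting_operator "states M \<Otimes>\<^sub>M beliefs M" "bellman_policy M \<pi>" "discount M"
    using discounting_bellman_policy[OF M \<gamma> \<pi>(1)] .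
  have "bellman M V x \<le> bellman_policy M \<pi> V x"
    using bellman_le[OF M(2) V s(2) policy_action[OF \<pi>(1) s(2)]] s by (simp add: bellman_policy_def)
  also have "\<dots> \<le> bellman M W x + discount M * c"
    using \<pi>.shift[of V W c x] V W le x \<pi>(2) by (simp add: bounded_measurable_eq)
  finally show "bellman M V x \<le> bellman M W x + discount M * c" .
qed (use M \<gamma> in \<open>auto simp: bellman_well_defined_def\<close>)

lemma nested_value_eq_iterate:
  assumes M: "is_bcr_mdp M" and \<pi>: "\<pi> \<in> stationary_policies M" and x: "x \<in> sb_dom M"
  shows "nested_value M \<pi> n x = (bellman_policy M \<pi> ^^ n) (\<lambda>x \<in> sb_dom M. 0) x"
  using x
proof (induction n arbitrary: x)
  case 0
  then show ?case by simp
next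
  case (Suc n)
  obtain s \<mu> where s: "x = (s, \<mu>)" "(s, \<mu>) \<in> sb_dom M"
    using Suc.prems by (cases x) auto
  let ?V = "(bellman_policy M \<pi> ^^ n) (\<lambda>x \<in> sb_dom M. 0)"
  have "composite_risk M \<mu> (one_step_cost M (nested_value M \<pi> n) s \<mu> (\<pi> (s, \<mu>)))
      = composite_risk M \<mu> (one_step_cost M ?V s \<mu> (\<pi> (s, \<mu>)))"
  proof (rule composite_risk_cong)
    fix \<xi> assume "\<xi> \<in> space (noise M)"
    from Suc.IH[OF next_state_in_domain[OF M s(2) policy_action[OF \<pi> s(2)] this]]
    show "one_step_cost M (nested_value M \<pi> n) s \<mu> (\<pi> (s, \<mu>)) \<xi>
        = one_step_cost M ?V s \<mu> (\<pi> (s, \<mu>)) \<xi>"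
      by (simp only: one_step_cost_def)
  qed
  also have "\<dots> = bellman_policy M \<pi> ?V (s, \<mu>)"
    unfolding bellman_policy_def using s(2) by (simp only: restrict_apply prod.case if_True)
  finally show ?case
    unfolding s(1) by (simp only: nested_value.simps funpow.simps o_apply prod.case)
qed

lemma policy_value_fixed_point:
  assumes M: "is_bcr_mdp M" "bellman_well_defined M" and \<gamma>: "0 \<le> discount M" "discount M < 1"
    and \<pi>: "\<pi> \<in> stationary_policies M"
  obtains V where "V \<in> bounded_measurable M" and "bellman_policy M \<pi> V = V"
    and "\<And>s \<mu>. (s, \<mu>) \<in> sb_dom M \<Longrightarrow> policy_value M \<pi> s \<mu> = V (s, \<mu>)"
proof -
  interpret discounting_operator "states M \<Otimes>\<^sub>M beliefs M" "bellman_policy M \<pi>" "discount M"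
    using discounting_bellman_policy[OF M \<gamma> \<pi>] .
  obtain V where V: "V \<in> bounded_measurable M" "bellman_policy M \<pi> V = V"
    and lim: "\<And>x. x \<in> sb_dom M \<Longrightarrow>
      (\<lambda>n. (bellman_policy M \<pi> ^^ n) (\<lambda>x \<in> sb_dom M. 0) x) \<longlonglongrightarrow> V x"
    using iteration_converges[of "\<lambda>x \<in> sb_dom M. 0"] zero_in_bounded_measurable[of M]
    unfolding bounded_measurable_eq space_pair_measure by metis
  have "policy_value M \<pi> s \<mu> = V (s, \<mu>)" if s: "(s, \<mu>) \<in> sb_dom M" for s \<mu>
    unfolding policy_value_def nested_value_eq_iterate[OF M(1) \<pi> s]
    using lim[OF s] by (rule limI)
  with V show thesis
    by (rule that)
qed

theorem theorem1:
  fixes M :: "('w, 'x, 's, 'a :: real_normed_vector) bcr_mdp"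
    and Cbar :: real
  assumes "is_bcr_mdp M"
    and "bellman_well_defined M"
    and "\<And>s a \<xi>. s \<in> space (states M) \<Longrightarrow> a \<in> actions M \<Longrightarrow> \<xi> \<in> space (noise M) \<Longrightarrow>
           \<bar>cost M s a \<xi>\<bar> \<le> Cbar"
    and "0 < discount M" and "discount M < 1"
  shows "(\<forall>\<pi> \<in> stationary_policies M.
            \<exists>!V. V \<in> bounded_measurable M \<and> bellman_policy M \<pi> V = V) \<and>
         (\<exists>Vstar \<in> bounded_measurable M.
            (\<forall>V \<in> bounded_measurable M. bellman M V = V \<longleftrightarrow> V = Vstar) \<and>
            (\<forall>V \<in> bounded_measurable M.
               ((\<forall>x \<in> sb_dom M. V x \<ge> bellman M V x) \<longrightarrow> (\<forall>x \<in> sb_dom M. V x \<ge> Vstar x)) \<and>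
               ((\<forall>x \<in> sb_dom M. V x \<le> bellman M V x) \<longrightarrow> (\<forall>x \<in> sb_dom M. V x \<le> Vstar x))) \<and>
            (\<forall>s \<in> space (states M). \<forall>\<mu> \<in> space (beliefs M).
               optimal_value M s \<mu> = Vstar (s, \<mu>)))"
proof -
  note M = assms(1,2)
  have \<gamma>: "0 \<le> discount M" "discount M < 1"
    using assms(4,5) by auto
  note B = bounded_measurable_eq[of M] and dom = space_pair_measure[of "states M" "beliefs M"]
  interpret T: discounting_operator "states M \<Otimes>\<^sub>M beliefs M" "bellman M" "discount M"
    using discounting_bellman[OF M \<gamma>] .
  have policy: "\<exists>!V. V \<in> bounded_measurable M \<and> bellman_policy M \<pi> V = V"
    if \<pi>: "\<pi> \<in> stationary_policies M" for \<pi>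
  proof -
    interpret \<pi>: discounting_operator "states M \<Otimes>\<^sub>M beliefs M" "bellman_policy M \<pi>" "discount M"
      using discounting_bellman_policy[OF M \<gamma> \<pi>] .
    obtain V where V: "V \<in> bounded_measurable M" "bellman_policy M \<pi> V = V"
      by (rule policy_value_fixed_point[OF M \<gamma> \<pi>])
    show ?thesis
    proof (rule ex1I[of _ V])
      show "W = V" if "W \<in> bounded_measurable M \<and> bellman_policy M \<pi> W = W" for W
        using \<pi>.fixed_point_unique[of W V] V that by (simp add: B)
    qed (use V in simp)
  qed
  obtain V where V: "V \<in> bounded_measurable M" "bellman M V = V"
    by (rule T.iteration_converges[OF zero_in_bounded_measurable[of M, unfolded B], folded B])
  have unique: "bellman M W = W \<longleftrightarrow> W = V" if "W \<in> bounded_measurable M" for W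
    using T.fixed_point_unique[of W V] V that unfolding B by auto
  have above: "V x \<le> W x"
    if "W \<in> bounded_measurable M" "\<And>x. x \<in> sb_dom M \<Longrightarrow> bellman M W x \<le> W x" "x \<in> sb_dom M" for W x
    using T.comparison[of V W x] V that unfolding B dom by simp
  have below: "W x \<le> V x"
    if "W \<in> bounded_measurable M" "\<And>x. x \<in> sb_dom M \<Longrightarrow> W x \<le> bellman M W x" "x \<in> sb_dom M" for W x
    using T.comparison[of W V x] V that unfolding B dom by simp
  have optimal: "optimal_value M s \<mu> = V (s, \<mu>)" if s: "(s, \<mu>) \<in> sb_dom M" for s \<mu>
  proof -
    \<comment> \<open>The value of a policy is a supersolution of the Bellman equation.\<close>
    have lower: "V (s, \<mu>) \<le> policy_value M \<pi> s \<mu>" if \<pi>: "\<pi> \<in> stationary_policies M" for \<pi>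
    proof -
      obtain W where W: "W \<in> bounded_measurable M" "bellman_policy M \<pi> W = W"
        and val: "policy_value M \<pi> s \<mu> = W (s, \<mu>)"
        by (rule policy_value_fixed_point[OF M \<gamma> \<pi>]) (use s in simp)
      have "bellman M W x \<le> W x" if x: "x \<in> sb_dom M" for x
      proof -
        obtain t \<nu> where t: "x = (t, \<nu>)" "(t, \<nu>) \<in> sb_dom M"
          using x by (cases x) auto
        have "bellman M W (t, \<nu>) \<le> bellman_policy M \<pi> W (t, \<nu>)"
          using bellman_le[OF M(2) W(1) t(2) policy_action[OF \<pi> t(2)]] t
          by (simp add: bellman_policy_def)
        then show ?thesis
          using W(2) t(1) by simp
      qed
      then show ?thesis
        using above[OF W(1) _ s] val by simp
    qed
    \<comment> \<open>A policy that is greedy for the fixed point attains the bound.\<close>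
    obtain \<pi> where \<pi>: "\<pi> \<in> stationary_policies M" "bellman_policy M \<pi> V = V"
      using minimizing_policy[OF M(2) V(1)] unfolding V(2) .
    obtain W where W: "W \<in> bounded_measurable M" "bellman_policy M \<pi> W = W"
      and val: "policy_value M \<pi> s \<mu> = W (s, \<mu>)"
      by (rule policy_value_fixed_point[OF M \<gamma> \<pi>(1)]) (use s in simp)
    have "W = V"
      using policy[OF \<pi>(1)] V(1) \<pi>(2) W by blast
    with val have "policy_value M \<pi> s \<mu> = V (s, \<mu>)"
      by simp
    then show ?thesis
      unfolding optimal_value_def using lower \<pi>(1)
      by (intro cInf_eq_minimum) force+
  qed
  show ?thesis
  proof (intro conjI ballI bexI[of _ V] impI)
    show "optimal_value M s \<mu> = V (s, \<mu>)"
      if "s \<in> space (states M)" "\<mu> \<in> space (beliefs M)" for s \<mu>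
      using optimal that by simp
  qed (use policy unique above below V(1) in blast)+
qed

end
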